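(* Let $a\ge 0$, $b\in\mathbb{R}$ and $F=F_{a,b}:\mathbb{R}^2\to\mathbb{R}^2$, $F(x,y)=(|x|-y+a,\;x-|y|+b)$. Then for each $\mathbf{x}\in\mathbb{R}^2$ there exists $n\ge 0$ (that may depend on $\mathbf{x}$) such that $F^n(\mathbf{x})\in\operatorname{Per}(F)$. Moreover, the set $\operatorname{Per}(F)$ is formed by one fixed point and, depending on $a$ and $b$, either exactly two periodic orbits of period $3$ or none (no other periodic points exist).
   Context: $\operatorname{Per}(F)$ denotes the set of all periodic points of $F$ (fixed points included). $F^n$ denotes the $n$-th iterate. The period of a periodic orbit means its minimal period. *)

theory Defs
  imports Complex_Main "HOL-Combinatorics.Orbits"
begin

definition F :: "real \<Rightarrow> real \<Rightarrow> real \<times> real \<Rightarrow> real \<times> real" where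
  "F a b = (\<lambda>(x, y). (\<bar>x\<bar> - y + a, x - \<bar>y\<bar> + b))"

definition Per :: "('a \<Rightarrow> 'a) \<Rightarrow> 'a set" where
  "Per f = {x. \<exists>n>0. (f ^^ n) x = x}"

(* Only meaningful for x in Per f. *)
definition min_period :: "('a \<Rightarrow> 'a) \<Rightarrow> 'a \<Rightarrow> nat" where
  "min_period f x = (LEAST n. 0 < n \<and> (f ^^ n) x = x)"

(* The library's orbit f x collects the iterates (f ^^ n) x with n > 0 only;
   for periodic x this is the full forward orbit, since x itself recurs. *)
definition periodic_orbit :: "('a \<Rightarrow> 'a) \<Rightarrow> nat \<Rightarrow> 'a set \<Rightarrow> bool" where
  "periodic_orbit f p S \<longleftrightarrow> (\<exists>x\<in>Per f. min_period f x = p \<and> S = orbit f x)"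

end

theory Submission
  imports Defs
begin

text \<open>
  The proof is organised around the ray
  \<open>{(t, t + b - a) | t. t \<ge> 2 * a - b}\<close>.

  \<^bold>\<open>Almost every point reaches the ray.\<close> On the first and the third quadrant the
  linear part of \<open>F\<close> has rank one; on the second and the fourth it is \<open>\<surd>2\<close> times a rotation
  by an odd multiple of 45 degrees, so its fourth power is multiplication by \<open>-4\<close>. The image of the
  first quadrant lies on the line carrying the ray, and a point of the lower half plane is thrown
  into the right half plane, where it turns through the fourth quadrant, leaves it into the first
  quadrant after at most four steps, and then falls onto the ray. Points
  that never reach the ray must therefore stay in the open second quadrant for ever. There every
  fourth iterate multiplies the displacement from \<open>((2 * a - b) / 5, (a + 2 * b) / 5)\<close> by \<open>-4\<close>,
  so the displacement is zero: the only such point is that centre, and it lies in the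
  open second quadrant only if \<open>b > 2 * a\<close>, in which case it is a fixed point.

  \<^bold>\<open>Dynamics on the ray.\<close> If \<open>b \<le> 2 * a\<close>, the ray lies in the first quadrant and collapses
  in one step to the fixed point \<open>(2 * a - b, a)\<close>. If \<open>b > 2 * a\<close>, put \<open>d = b - 2 * a\<close>. The point
  of the ray with parameter \<open>t\<close> either falls onto an explicit 3-cycle, or
  \<open>-d/2 < t < 0\<close> and three steps lead back to the ray with parameter \<open>4 * t + d\<close>. This affine
  map expands, so only its fixed parameter \<open>t = -d/3\<close> avoids the first cycle, and
  the point with this parameter lies on a second 3-cycle.

  \<^bold>\<open>Periodic points.\<close> Once every orbit is known to enter a finite invariant set,
  periodic points can lie nowhere else, because a periodic point recurs.
\<close>

section \<open>Orbits that enter a set\<close>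

definition reaches :: "('a \<Rightarrow> 'a) \<Rightarrow> 'a set \<Rightarrow> 'a \<Rightarrow> bool" where
  "reaches f C x \<longleftrightarrow> (\<exists>n. (f ^^ n) x \<in> C)"

lemma reaches_self: "x \<in> C \<Longrightarrow> reaches f C x"
  unfolding reaches_def by (rule exI[of _ 0]) simp

lemma reaches_step:
  assumes "reaches f C (f x)" shows "reaches f C x"
proof -
  from assms obtain n where "(f ^^ n) (f x) \<in> C" unfolding reaches_def by blast
  then have "(f ^^ Suc n) x \<in> C" by (simp add: funpow_swap1)
  then show ?thesis unfolding reaches_def by blast
qed

lemma reaches_next: "f x \<in> C \<Longrightarrow> reaches f C x"
  by (rule reaches_step) (rule reaches_self)

lemma reaches_trans:
  assumes "reaches f D x" and "\<And>y. y \<in> D \<Longrightarrow> reaches f C y"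
  shows "reaches f C x"
proof -
  from assms(1) obtain n where "(f ^^ n) x \<in> D" unfolding reaches_def by blast
  from assms(2)[OF this] obtain m where "(f ^^ m) ((f ^^ n) x) \<in> C"
    unfolding reaches_def by blast
  then have "(f ^^ (m + n)) x \<in> C" by (simp add: funpow_add)
  then show ?thesis unfolding reaches_def by blast
qed

lemma reaches_mono: "reaches f C x \<Longrightarrow> C \<subseteq> D \<Longrightarrow> reaches f D x"
  unfolding reaches_def by blast

text \<open>
  A periodic point recurs at every multiple of its period, in particular at some time after its
  orbit has been captured by \<open>C\<close>.
\<close>

lemma Per_subset_of_reaches:
  assumes inv: "\<And>y. y \<in> C \<Longrightarrow> f y \<in> C" and reach: "\<And>x. reaches f C x"
  shows "Per f \<subseteq> C"
proof
  fix x assume "x \<in> Per f"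
  then obtain N where N: "N > 0" "(f ^^ N) x = x" unfolding Per_def by blast
  obtain n where n: "(f ^^ n) x \<in> C" using reach unfolding reaches_def by blast
  have stay: "(f ^^ k) y \<in> C" if "y \<in> C" for k y
    using that inv by (induction k) auto
  have "(f ^^ (N * n)) x = x"
    using N(2) by (induction n) (simp_all add: funpow_add)
  moreover have "N * n = (N * n - n) + n" using N(1) by simp
  ultimately have "x = (f ^^ (N * n - n)) ((f ^^ n) x)"
    by (metis funpow_add comp_apply)
  then show "x \<in> C" using stay[OF n] by metis
qed

lemma fixed_point_in_Per: "f x = x \<Longrightarrow> x \<in> Per f"
  unfolding Per_def by (auto intro!: exI[of _ 1])

lemma three_cycle_periodic:
  assumes "f x = y" "f y = z" "f z = x" and "x \<noteq> y"
  shows "periodic_orbit f 3 {x, y, z}" and "{x, y, z} \<subseteq> Per f"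
proof -
  have three: "(f ^^ 3) w = f (f (f w))" for w by (simp add: numeral_3_eq_3)
  have "(f ^^ 3) w = w" if "w \<in> {x, y, z}" for w
    using that by (auto simp: three assms(1-3))
  then have "w \<in> Per f" if "w \<in> {x, y, z}" for w
    using that unfolding Per_def by (intro CollectI exI[of _ 3]) simp
  then show per: "{x, y, z} \<subseteq> Per f" by blast
  have "min_period f x = 3" unfolding min_period_def
  proof (rule Least_equality)
    show "0 < (3::nat) \<and> (f ^^ 3) x = x" by (simp add: three assms(1-3))
  next
    fix n assume n: "0 < n \<and> (f ^^ n) x = x"
    \<comment> \<open>If \<open>f (f x) = x\<close>, then \<open>z = x\<close> and hence \<open>y = f x = f z = x\<close>.\<close>
    have "n \<noteq> 1" "n \<noteq> 2" using n assms by (auto simp: numeral_2_eq_2)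
    then show "3 \<le> n" using n by linarith
  qed
  moreover have "orbit f x = {x, y, z}"
  proof
    show "orbit f x \<subseteq> {x, y, z}"
    proof
      fix w assume "w \<in> orbit f x"
      then show "w \<in> {x, y, z}" by induction (use assms in auto)
    qed
    have "y \<in> orbit f x" using orbit.base[of f x] assms by simp
    moreover from this have "z \<in> orbit f x" using orbit.step[of y f x] assms by simp
    moreover from this have "x \<in> orbit f x" using orbit.step[of z f x] assms by simp
    ultimately show "{x, y, z} \<subseteq> orbit f x" by simp
  qed
  ultimately show "periodic_orbit f 3 {x, y, z}"
    unfolding periodic_orbit_def using per by blast
qed

lemma bounded_geometric_imp_zero:
  fixes c e B :: real
  assumes "\<bar>c\<bar> > 1" and "\<And>k. \<bar>c ^ k * e\<bar> \<le> B"
  shows "e = 0"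
proof (rule ccontr)
  assume "e \<noteq> 0"
  obtain k where "B / \<bar>e\<bar> < \<bar>c\<bar> ^ k" using real_arch_pow[OF assms(1)] by blast
  then have "B < \<bar>c ^ k * e\<bar>"
    using \<open>e \<noteq> 0\<close> by (simp add: divide_less_eq abs_mult power_abs)
  then show False using assms(2)[of k] by linarith
qed

section \<open>Reaching the ray\<close>

lemma F_apply: "F a b (x, y) = (\<bar>x\<bar> - y + a, x - \<bar>y\<bar> + b)"
  by (simp add: F_def)

definition ray :: "real \<Rightarrow> real \<Rightarrow> (real \<times> real) set" where
  "ray a b = {(t, t + b - a) | t. t \<ge> 2 * a - b}"

lemma mem_ray: "(x, y) \<in> ray a b \<longleftrightarrow> y = x + b - a \<and> x \<ge> 2 * a - b"
  by (auto simp: ray_def)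

lemma upper_right_onto_ray:
  assumes "x \<ge> 0" "y \<ge> 0" "x - y \<ge> a - b"
  shows "reaches (F a b) (ray a b) (x, y)"
  using assms by (intro reaches_next) (simp add: F_apply mem_ray)

text \<open>
  The image \<open>(x', y')\<close> of a point of the lower half plane satisfies \<open>x' \<ge> 0\<close> and
  \<open>x' - y' \<ge> a - b\<close>. If \<open>y' \<ge> 0\<close>, the next abscissa is therefore at least \<open>2 * a - b\<close>, which
  is where the bound in the definition of the ray comes from. So a point of the lower half plane
  that never reaches the ray has to stay below the axis.
\<close>

lemma lower_step:
  assumes "a \<ge> 0" "y \<le> 0" and "\<not> reaches (F a b) (ray a b) (x, y)"
  shows "\<not> reaches (F a b) (ray a b) (\<bar>x\<bar> - y + a, x + y + b)"
    and "x + y + b < 0"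
proof -
  show *: "\<not> reaches (F a b) (ray a b) (\<bar>x\<bar> - y + a, x + y + b)"
    using assms reaches_step[of "F a b" "ray a b" "(x, y)"] by (auto simp: F_apply)
  show "x + y + b < 0"
  proof (rule ccontr)
    assume "\<not> ?thesis"
    then have "reaches (F a b) (ray a b) (\<bar>x\<bar> - y + a, x + y + b)"
      using assms(1,2) by (intro upper_right_onto_ray) linarith+
    with * show False ..
  qed
qed

text \<open>
  Four steps inside the fourth quadrant are a homothety of ratio \<open>-4\<close> with centre \<open>(-b, a)\<close>;
  as \<open>a \<ge> 0\<close>, they would end at the nonnegative ordinate \<open>5 * a - 4 * y\<close>.
\<close>

lemma lower_right_reaches_ray:
  assumes a: "a \<ge> 0" and "x \<ge> 0" "y \<le> 0"
  shows "reaches (F a b) (ray a b) (x, y)"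
proof (rule ccontr)
  let ?never = "\<lambda>x y. \<not> reaches (F a b) (ray a b) (x, y)"
  have step: "?never (x - y + a) (x + y + b) \<and> x - y + a \<ge> 0 \<and> x + y + b < 0"
    if "?never x y" "x \<ge> 0" "y \<le> 0" for x y
    using lower_step[OF a that(3) that(1)] that a by simp
  assume "?never x y"
  from step[OF this assms(2,3)]
  have 1: "?never (x - y + a) (x + y + b)" "x - y + a \<ge> 0" "x + y + b \<le> 0" by auto
  from step[OF 1]
  have 2: "?never (- 2 * y + 2 * a - b) (2 * x + a + 2 * b)"
    "- 2 * y + 2 * a - b \<ge> 0" "2 * x + a + 2 * b \<le> 0"
    by (auto simp: algebra_simps)
  from step[OF 2]
  have 3: "?never (- 2 * x - 2 * y + 2 * a - 3 * b) (2 * x - 2 * y + 3 * a + 2 * b)"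
    "- 2 * x - 2 * y + 2 * a - 3 * b \<ge> 0" "2 * x - 2 * y + 3 * a + 2 * b \<le> 0"
    by (auto simp: algebra_simps)
  from step[OF 3] have "5 * a - 4 * y < 0" by linarith
  then show False using a assms(3) by linarith
qed

lemma lower_reaches_ray:
  assumes a: "a \<ge> 0" and y: "y \<le> 0"
  shows "reaches (F a b) (ray a b) (x, y)"
proof (rule ccontr)
  assume "\<not> ?thesis"
  from lower_step[OF a y this] show False
    using lower_right_reaches_ray[OF a, of "\<bar>x\<bar> - y + a" "x + y + b"] a y by simp
qed

text \<open>
  The first quadrant is mapped to the line \<open>{(t, t + b - a)}\<close>, so it remains to treat the points
  of this line above the axis and off the ray. If \<open>t \<ge> 0\<close>, the next iterate is the end point of
  the ray. If \<open>t < 0\<close>, it is \<open>(2 * a - b - 2 * t, a)\<close>; its abscissa is positive, since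
  otherwise \<open>2 * a - b \<le> 2 * t < t\<close> and the point was on the ray already, and thus
  one more step leads onto the ray.
\<close>

lemma line_reaches_ray:
  assumes a: "a \<ge> 0"
  shows "reaches (F a b) (ray a b) (t, t + b - a)"
proof -
  consider "t \<ge> 2 * a - b" | "t + b - a \<le> 0"
    | "t \<ge> 0" "t + b - a > 0" "t < 2 * a - b"
    | "t < 0" "t + b - a > 0" "t < 2 * a - b" by linarith
  then show ?thesis
  proof cases
    case 1
    then show ?thesis by (intro reaches_self) (simp add: mem_ray)
  next
    case 2
    then show ?thesis by (rule lower_reaches_ray[OF a])
  next
    case 3
    then have "F a b (t, t + b - a) = (2 * a - b, a)" by (simp add: F_apply)
    then show ?thesis by (intro reaches_next) (simp add: mem_ray)
  next
    case 4
    then have "F a b (t, t + b - a) = (2 * a - b - 2 * t, a)" by (simp add: F_apply)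
    moreover have "reaches (F a b) (ray a b) (2 * a - b - 2 * t, a)"
      using a 4 by (intro upper_right_onto_ray) linarith+
    ultimately show ?thesis by (metis reaches_step)
  qed
qed

lemma upper_right_reaches_ray:
  assumes a: "a \<ge> 0" and "x \<ge> 0" "y \<ge> 0"
  shows "reaches (F a b) (ray a b) (x, y)"
proof -
  have "F a b (x, y) = (x - y + a, (x - y + a) + b - a)"
    using assms by (simp add: F_apply)
  then show ?thesis using line_reaches_ray[OF a] by (metis reaches_step)
qed

text \<open>
  A point that never reaches the ray has its whole orbit in the open second quadrant, where \<open>F\<close> is
  affine and \<open>F\<^sup>4\<close> is the homothety of ratio \<open>-4\<close> about its centre. The signs
  of the coordinates bound the displacement from one side only, but as the
  ratio is negative, two consecutive bounds give a two-sided one.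
\<close>

lemma never_reaches_ray:
  assumes a: "a \<ge> 0" and never: "\<not> reaches (F a b) (ray a b) (x, y)"
  shows "x = (2 * a - b) / 5" "y = (a + 2 * b) / 5" "2 * a < b"
proof -
  let ?never = "\<lambda>x y. \<not> reaches (F a b) (ray a b) (x, y)"
  let ?u = "(2 * a - b) / 5" and ?v = "(a + 2 * b) / 5"
  have quadrant: "x < 0 \<and> y > 0" if "?never x y" for x y
    using that upper_right_reaches_ray[OF a, of x y] lower_reaches_ray[OF a, of y]
    by fastforce
  have step: "?never (- x - y + a) (x - y + b)" if "?never x y" for x y
    using quadrant[OF that] that reaches_step[of "F a b" "ray a b" "(x, y)"]
    by (auto simp: F_apply)
  have four: "?never (2 * a - b - 4 * x) (a + 2 * b - 4 * y)" if "?never x y" for x y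
    using step[OF step[OF step[OF step[OF that]]]] by (simp add: algebra_simps)
  have all: "?never (?u + (-4) ^ k * (x - ?u)) (?v + (-4) ^ k * (y - ?v))" for k
  proof (induction k)
    case 0
    then show ?case using never by simp
  next
    case (Suc k)
    have u: "2 * a - b - 4 * (?u + (-4) ^ k * (x - ?u)) = ?u + (-4) ^ Suc k * (x - ?u)"
      and v: "a + 2 * b - 4 * (?v + (-4) ^ k * (y - ?v)) = ?v + (-4) ^ Suc k * (y - ?v)"
      by (simp_all add: field_simps)
    show ?case using four[OF Suc] unfolding u v .
  qed
  have "\<bar>(-4) ^ k * (x - ?u)\<bar> \<le> \<bar>?u\<bar>" for k
  proof -
    have "?u + (-4) ^ k * (x - ?u) < 0" "?u - 4 * ((-4) ^ k * (x - ?u)) < 0"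
      using quadrant[OF all[of k]] quadrant[OF all[of "Suc k"]] by simp_all
    then show ?thesis by linarith
  qed
  then show x: "x = ?u" using bounded_geometric_imp_zero[of "-4" "x - ?u" "\<bar>?u\<bar>"] by simp
  have "\<bar>(-4) ^ k * (y - ?v)\<bar> \<le> \<bar>?v\<bar>" for k
  proof -
    have "?v + (-4) ^ k * (y - ?v) > 0" "?v - 4 * ((-4) ^ k * (y - ?v)) > 0"
      using quadrant[OF all[of k]] quadrant[OF all[of "Suc k"]] by simp_all
    then show ?thesis by linarith
  qed
  then show "y = ?v" using bounded_geometric_imp_zero[of "-4" "y - ?v" "\<bar>?v\<bar>"] by simp
  show "2 * a < b" using quadrant[OF never] x by simp
qed

section \<open>Dynamics on the ray\<close>

lemma ray_collapses:
  assumes "a \<ge> 0" "b \<le> 2 * a" "q \<in> ray a b"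
  shows "F a b q = (2 * a - b, a)"
  using assms by (auto simp: ray_def F_apply)

definition attracting_cycle :: "real \<Rightarrow> real \<Rightarrow> (real \<times> real) set" where
  "attracting_cycle a b = {(2 * a - b, a), (b - 2 * a, a), (b - 2 * a, 2 * b - 3 * a)}"

definition saddle_cycle :: "real \<Rightarrow> real \<Rightarrow> (real \<times> real) set" where
  "saddle_cycle a b = {((2 * a - b) / 3, a), ((b - 2 * a) / 3, (2 * b - a) / 3),
    ((2 * a - b) / 3, (2 * b - a) / 3)}"

context
  fixes a b :: real
  assumes a: "a \<ge> 0" and b: "2 * a < b"
begin

lemma attracting_cycle_steps:
  "F a b (2 * a - b, a) = (b - 2 * a, a)"
  "F a b (b - 2 * a, a) = (b - 2 * a, 2 * b - 3 * a)"
  "F a b (b - 2 * a, 2 * b - 3 * a) = (2 * a - b, a)"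
  using a b by (auto simp: F_apply)

lemma saddle_cycle_steps:
  "F a b ((2 * a - b) / 3, a) = ((b - 2 * a) / 3, (2 * b - a) / 3)"
  "F a b ((b - 2 * a) / 3, (2 * b - a) / 3) = ((2 * a - b) / 3, (2 * b - a) / 3)"
  "F a b ((2 * a - b) / 3, (2 * b - a) / 3) = ((2 * a - b) / 3, a)"
  using a b by (auto simp: F_apply abs_if field_simps)

lemma repelling_fixed_point:
  "F a b ((2 * a - b) / 5, (a + 2 * b) / 5) = ((2 * a - b) / 5, (a + 2 * b) / 5)"
  using a b by (auto simp: F_apply abs_if field_simps)

lemma ray_nonneg_reaches_attracting_cycle:
  assumes "t \<ge> 0"
  shows "reaches (F a b) (attracting_cycle a b) (t, t + b - a)"
  using assms a b
  by (intro reaches_next) (simp add: F_apply attracting_cycle_def)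

text \<open>
  A negative parameter \<open>t\<close> is mapped to the point \<open>(s, a)\<close> with \<open>s = 2 * a - b - 2 * t\<close>. If
  \<open>s \<ge> 0\<close>, the next point lies on the ray with parameter \<open>s\<close>; otherwise the
  orbit passes through \<open>(-s, s + b - a)\<close> and is back on the ray one step later.
\<close>

lemma ray_step:
  assumes t: "t \<ge> 2 * a - b" and never: "\<not> reaches (F a b) (attracting_cycle a b) (t, t + b - a)"
  shows "2 * a - b < 2 * t" "t < 0"
    and "\<not> reaches (F a b) (attracting_cycle a b) (4 * t + (b - 2 * a), (4 * t + (b - 2 * a)) + b - a)"
proof -
  let ?never = "\<lambda>q. \<not> reaches (F a b) (attracting_cycle a b) q"
  have step: "?never (F a b q)" if "?never q" for q using that by (metis reaches_step)
  show "t < 0" using never ray_nonneg_reaches_attracting_cycle not_le by blast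
  then have "F a b (t, t + b - a) = (2 * a - b - 2 * t, a)"
    using t a by (simp add: F_apply)
  with step[OF never] have 1: "?never (2 * a - b - 2 * t, a)" by simp
  show s: "2 * a - b < 2 * t"
  proof (rule ccontr)
    let ?s = "2 * a - b - 2 * t"
    assume "\<not> ?thesis"
    then have "?s \<ge> 0" by simp
    then have "F a b (?s, a) = (?s, ?s + b - a)" using a by (simp add: F_apply)
    with step[OF 1] ray_nonneg_reaches_attracting_cycle[OF \<open>?s \<ge> 0\<close>] show False by simp
  qed
  then have "F a b (2 * a - b - 2 * t, a) = (2 * t - 2 * a + b, a - 2 * t)"
    using a by (simp add: F_apply)
  with step[OF 1] have 2: "?never (2 * t - 2 * a + b, a - 2 * t)" by simp
  have "F a b (2 * t - 2 * a + b, a - 2 * t)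
      = (4 * t + (b - 2 * a), (4 * t + (b - 2 * a)) + b - a)"
    using s \<open>t < 0\<close> a by (simp add: F_apply)
  with step[OF 2] show "?never (4 * t + (b - 2 * a), (4 * t + (b - 2 * a)) + b - a)" by simp
qed

lemma ray_reaches_cycle:
  assumes "q \<in> ray a b"
  shows "reaches (F a b) (attracting_cycle a b \<union> saddle_cycle a b) q"
proof (cases "reaches (F a b) (attracting_cycle a b) q")
  case True
  then show ?thesis by (rule reaches_mono) simp
next
  case False
  let ?c = "(2 * a - b) / 3"
  obtain t where t: "q = (t, t + b - a)" "t \<ge> 2 * a - b"
    using assms by (auto simp: ray_def)
  define T where "T k = ?c + 4 ^ k * (t - ?c)" for k :: nat
  have T_Suc: "T (Suc k) = 4 * T k + (b - 2 * a)" for k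
    by (simp add: T_def field_simps)
  have all: "\<not> reaches (F a b) (attracting_cycle a b) (T k, T k + b - a) \<and> T k \<ge> 2 * a - b" for k
  proof (induction k)
    case 0
    then show ?case using False t by (simp add: T_def)
  next
    case (Suc k)
    then show ?case using ray_step[of "T k"] unfolding T_Suc by force
  qed
  have "\<bar>4 ^ k * (t - ?c)\<bar> \<le> b - 2 * a" for k
    using ray_step(1,2)[of "T k"] all[of k] b unfolding T_def by (simp add: abs_if field_simps)
  then have "t = ?c" using bounded_geometric_imp_zero[of 4 "t - ?c" "b - 2 * a"] by simp
  then have "q = (?c, (2 * b - a) / 3)" using t(1) by (simp add: field_simps)
  then have "q \<in> saddle_cycle a b" by (simp add: saddle_cycle_def)
  then show ?thesis by (intro reaches_self) simp
qed

end

section \<open>Classification of the periodic points\<close>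

theorem theoremA:
  fixes a b :: real
  assumes "a \<ge> 0"
  shows "(\<forall>x. \<exists>n. (F a b ^^ n) x \<in> Per (F a b)) \<and>
    (\<exists>p. F a b p = p \<and>
      (Per (F a b) = {p} \<or>
       (\<exists>S T. S \<noteq> T \<and> periodic_orbit (F a b) 3 S \<and> periodic_orbit (F a b) 3 T \<and>
          Per (F a b) = {p} \<union> S \<union> T)))"
proof -
  have captured: "(\<forall>x. \<exists>n. (F a b ^^ n) x \<in> Per (F a b)) \<and> Per (F a b) = C"
    if "\<And>q. q \<in> C \<Longrightarrow> F a b q \<in> C" "\<And>x. reaches (F a b) C x" "C \<subseteq> Per (F a b)" for C
    using Per_subset_of_reaches[of C, OF that(1,2)] that(2,3)
    unfolding reaches_def by blast
  show ?thesis
  proof (cases "b \<le> 2 * a")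
    case True
    let ?p = "(2 * a - b, a)"
    have fixed: "F a b ?p = ?p" using True assms by (simp add: F_apply)
    have "reaches (F a b) {?p} x" for x
    proof -
      have "reaches (F a b) (ray a b) x"
        using never_reaches_ray(3)[OF assms, of b] True by (cases x) fastforce
      then show ?thesis
        by (rule reaches_trans)
          (intro reaches_next, simp add: ray_collapses[OF assms True])
    qed
    with captured[of "{?p}"] fixed fixed_point_in_Per[where f = "F a b", OF fixed] show ?thesis by auto
  next
    case False
    then have b: "2 * a < b" by simp
    let ?p = "((2 * a - b) / 5, (a + 2 * b) / 5)"
    let ?A = "attracting_cycle a b" and ?B = "saddle_cycle a b"
    note fixed = repelling_fixed_point[OF assms b]
    have A: "periodic_orbit (F a b) 3 ?A" "?A \<subseteq> Per (F a b)"
      unfolding attracting_cycle_def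
      using three_cycle_periodic[OF attracting_cycle_steps[OF assms b]] b by auto
    have B: "periodic_orbit (F a b) 3 ?B" "?B \<subseteq> Per (F a b)"
      unfolding saddle_cycle_def
      using three_cycle_periodic[OF saddle_cycle_steps[OF assms b]] b by auto
    have "(b - 2 * a, a) \<in> ?A" "(b - 2 * a, a) \<notin> ?B"
      using b by (auto simp: attracting_cycle_def saddle_cycle_def)
    then have "?A \<noteq> ?B" by metis
    have "F a b q \<in> {?p} \<union> ?A \<union> ?B" if "q \<in> {?p} \<union> ?A \<union> ?B" for q
      using that fixed attracting_cycle_steps[OF assms b] saddle_cycle_steps[OF assms b]
      unfolding attracting_cycle_def saddle_cycle_def by auto
    moreover have "reaches (F a b) ({?p} \<union> ?A \<union> ?B) x" for x
    proof (cases "reaches (F a b) (ray a b) x")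
      case True
      then have "reaches (F a b) (?A \<union> ?B) x"
        by (rule reaches_trans) (rule ray_reaches_cycle[OF assms b])
      then show ?thesis by (rule reaches_mono) auto
    next
      case False
      then have "x = ?p" using never_reaches_ray(1,2)[OF assms, of b] by (cases x) auto
      then show ?thesis by (intro reaches_self) simp
    qed
    moreover have "{?p} \<union> ?A \<union> ?B \<subseteq> Per (F a b)"
      using A(2) B(2) fixed_point_in_Per[where f = "F a b", OF fixed] by simp
    ultimately have "(\<forall>x. \<exists>n. (F a b ^^ n) x \<in> Per (F a b)) \<and> Per (F a b) = {?p} \<union> ?A \<union> ?B"
      by (rule captured)
    with fixed A(1) B(1) \<open>?A \<noteq> ?B\<close> show ?thesis by blast
  qed
qed

end
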